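(* Let $\varepsilon,\tau_1,\tau_2>0$, let $\mathcal{H}_1$ and $\mathcal{H}_2$ be finite-dimensional Hilbert spaces with dimensions $d_1$ and $d_2$ respectively. Let $C$ be a Hermitian operator on $\mathcal{H}_1\otimes\mathcal{H}_2$, and let $\rho$ and $\sigma$ be Hermitian (strictly) positive definite operators on $\mathcal{H}_1$ and $\mathcal{H}_2$ respectively. Then $$\inf_{\Gamma\in\mathrm{H}_{\geq}(\mathcal{H}_1\otimes\mathcal{H}_2)}\mathcal{F}^{\tau_1,\tau_2}_{\varepsilon}(\Gamma)\ \geq\ \sup_{U\in\mathrm{H}(\mathcal{H}_1),\ V\in\mathrm{H}(\mathcal{H}_2)}\mathcal{D}^{\tau_1,\tau_2}_{\varepsilon}(U,V).$$
   Context: $\mathrm{H}(\mathcal{H})$ is the set of Hermitian operators on $\mathcal{H}$ and $\mathrm{H}_{\geq}(\mathcal{H})$ the set of Hermitian positive semi-definite operators on $\mathcal{H}$. For $\Gamma\in\mathrm{H}_{\geq}(\mathcal{H}_1\otimes\mathcal{H}_2)$, the partial traces are $\Gamma_1=\mathrm{Tr}_2[\Gamma]$ (an operator on $\mathcal{H}_1$) and $\Gamma_2=\mathrm{Tr}_1[\Gamma]$ (an operator on $\mathcal{H}_2$). The primal functional $\mathcal{F}^{\tau_1,\tau_2}_{\varepsilon}:\mathrm{H}_{\geq}(\mathcal{H}_1\otimes\mathcal{H}_2)\to\mathbb{R}\cup\{+\infty\}$ is $$\mathcal{F}^{\tau_1,\tau_2}_{\varepsilon}(\Gamma)=\mathrm{Tr}[C\Gamma]+\varepsilon\mathcal{S}[\Gamma]+\tau_1\mathcal{E}[\Gamma_1|\rho]+\tau_2\mathcal{E}[\Gamma_2|\sigma],$$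 with von Neumann entropy $\mathcal{S}[\Gamma]=\mathrm{Tr}[\Gamma(\log\Gamma-\mathrm{Id})]$ and Umegaki relative entropy, for $\gamma_1,\gamma_2\in\mathrm{H}_{\geq}(\mathcal{H})$, $$\mathcal{E}[\gamma_1|\gamma_2]=\mathrm{Tr}[\gamma_1(\log\gamma_1-\log\gamma_2-\mathrm{Id})+\gamma_2]\ \text{ if }\ker\gamma_2\subset\ker\gamma_1,\qquad \mathcal{E}[\gamma_1|\gamma_2]=+\infty\ \text{ otherwise},$$ with the convention $0\log 0=0$ ($\mathrm{Tr}[\gamma_1\log\gamma_2]$ being computed on the range of $\gamma_2$). The dual functional $\mathcal{D}^{\tau_1,\tau_2}_{\varepsilon}:\mathrm{H}(\mathcal{H}_1)\times\mathrm{H}(\mathcal{H}_2)\to\mathbb{R}$ is $$\mathcal{D}^{\tau_1,\tau_2}_{\varepsilon}(U,V)=-\tau_1\mathrm{Tr}\left[\left(\exp\left(-\tfrac{U}{\tau_1}\right)-\mathrm{Id}\right)\rho\right]-\tau_2\mathrm{Tr}\left[\left(\exp\left(-\tfrac{V}{\tau_2}\right)-\mathrm{Id}\right)\sigma\right]-\varepsilon\mathrm{Tr}\left[\exp\left(\frac{U\oplus V-C}{\varepsilon}\right)\right],$$ where $U\oplus V=U\otimes\mathrm{Id}+\mathrm{Id}\otimes V$ is the Kronecker sum. *)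

theory Defs
  imports "HOL-Analysis.Analysis"
begin

text \<open>
  A finite-dimensional complex Hilbert space is \<open>\<complex>\<^sup>d\<close> in an orthonormal basis indexed by a finite
  type \<open>'n\<close> with \<open>CARD('n) = d\<close>; an operator on it is its matrix. The tensor product of the
  spaces indexed by \<open>'n\<close> and \<open>'m\<close> is the space indexed by \<open>'n \<times> 'm\<close>. Operators are composed by
  \<open>**\<close> and the identity is \<open>mat 1\<close>: the type-class operations \<open>*\<close> and \<open>1\<close> on this type
  are componentwise.
\<close>

type_synonym 'n cmat = "complex ^ 'n ^ 'n"

definition cadjoint :: "'n::finite cmat \<Rightarrow> 'n cmat" where
  "cadjoint A = map_matrix cnj (transpose A)"

definition hermitian :: "'n::finite cmat \<Rightarrow> bool" where
  "hermitian A \<longleftrightarrow> cadjoint A = A"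

definition unitary :: "'n::finite cmat \<Rightarrow> bool" where
  "unitary U \<longleftrightarrow> U ** cadjoint U = mat 1 \<and> cadjoint U ** U = mat 1"

text \<open>
  On \<open>complex ^ 'n\<close> the library's \<open>x \<bullet> y\<close> is the real part of the Hermitian inner product;
  for Hermitian \<open>A\<close> the number \<open>\<langle>x, A x\<rangle>\<close> is real, so nothing is lost here.
\<close>

definition psd :: "'n::finite cmat \<Rightarrow> bool" where
  "psd A \<longleftrightarrow> hermitian A \<and> (\<forall>x. 0 \<le> x \<bullet> (A *v x))"

definition posdef :: "'n::finite cmat \<Rightarrow> bool" where
  "posdef A \<longleftrightarrow> hermitian A \<and> (\<forall>x. x \<noteq> 0 \<longrightarrow> 0 < x \<bullet> (A *v x))"

definition mkernel :: "'n::finite cmat \<Rightarrow> (complex ^ 'n) set" where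
  "mkernel A = {x. A *v x = 0}"

text \<open>Functional calculus of Hermitian operators.\<close>

definition rdiag :: "('n::finite \<Rightarrow> real) \<Rightarrow> 'n cmat" where
  "rdiag d = (\<chi> i j. if i = j then complex_of_real (d i) else 0)"

definition hfun :: "(real \<Rightarrow> real) \<Rightarrow> 'n::finite cmat \<Rightarrow> 'n cmat" where
  "hfun f A = (THE B. \<exists>U d. unitary U \<and> A = U ** rdiag d ** cadjoint U \<and>
                            B = U ** rdiag (f \<circ> d) ** cadjoint U)"

lemma rdiag_mult_left: "(rdiag d ** A) $ i $ j = complex_of_real (d i) * A $ i $ j"
proof -
  have "(rdiag d ** A) $ i $ j =
      (\<Sum>k\<in>UNIV. if i = k then complex_of_real (d k) * A $ k $ j else 0)"
    unfolding rdiag_def matrix_matrix_mult_def vec_lambda_beta by (rule sum.cong) auto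
  then show ?thesis by simp
qed

lemma rdiag_mult_right: "(A ** rdiag d) $ i $ j = A $ i $ j * complex_of_real (d j)"
proof -
  have "(A ** rdiag d) $ i $ j =
      (\<Sum>k\<in>UNIV. if k = j then A $ i $ k * complex_of_real (d k) else 0)"
    unfolding rdiag_def matrix_matrix_mult_def vec_lambda_beta by (rule sum.cong) auto
  then show ?thesis by simp
qed

lemma hfun_unique:
  assumes U: "unitary U" and V: "unitary V"
    and eq: "U ** rdiag d ** cadjoint U = V ** rdiag e ** cadjoint V"
  shows "U ** rdiag (f \<circ> d) ** cadjoint U = V ** rdiag (f \<circ> e) ** cadjoint V"
proof -
  define W where "W = cadjoint V ** U"
  have UU: "cadjoint U ** U = mat 1" "U ** cadjoint U = mat 1"
    and VV: "cadjoint V ** V = mat 1" "V ** cadjoint V = mat 1"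
    using U V by (auto simp: unitary_def)
  have "W ** rdiag d = cadjoint V ** (U ** rdiag d ** cadjoint U) ** U"
    by (metis W_def UU(1) matrix_mul_assoc matrix_mul_rid)
  also have "\<dots> = rdiag e ** W"
    unfolding eq by (metis W_def VV(1) matrix_mul_assoc matrix_mul_lid)
  finally have comm: "W ** rdiag d = rdiag e ** W" .
  have "W ** rdiag (f \<circ> d) = rdiag (f \<circ> e) ** W"
  proof -
    have "(W ** rdiag (f \<circ> d)) $ i $ j = (rdiag (f \<circ> e) ** W) $ i $ j" for i j
    proof -
      have "W $ i $ j * complex_of_real (d j) = complex_of_real (e i) * W $ i $ j"
        using arg_cong[OF comm, of "\<lambda>M. M $ i $ j"]
        by (simp add: rdiag_mult_left rdiag_mult_right)
      then have "W $ i $ j = 0 \<or> d j = e i" by (auto simp: mult.commute)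
      then show ?thesis by (auto simp: rdiag_mult_left rdiag_mult_right)
    qed
    then show ?thesis by (simp add: vec_eq_iff)
  qed
  moreover have "V ** W = U"
    by (metis W_def VV(2) matrix_mul_assoc matrix_mul_lid)
  ultimately show ?thesis
    by (metis W_def UU(2) matrix_mul_assoc matrix_mul_rid)
qed

lemma hfun_eq:
  assumes "unitary U"
  shows "hfun f (U ** rdiag d ** cadjoint U) = U ** rdiag (f \<circ> d) ** cadjoint U"
  unfolding hfun_def
proof (rule the_equality)
  show "\<exists>W e. unitary W \<and> U ** rdiag d ** cadjoint U = W ** rdiag e ** cadjoint W \<and>
      U ** rdiag (f \<circ> d) ** cadjoint U = W ** rdiag (f \<circ> e) ** cadjoint W"
    using assms by blast
next
  fix B
  assume "\<exists>W e. unitary W \<and> U ** rdiag d ** cadjoint U = W ** rdiag e ** cadjoint W \<and>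
      B = W ** rdiag (f \<circ> e) ** cadjoint W"
  then obtain W e where W: "unitary W"
      "U ** rdiag d ** cadjoint U = W ** rdiag e ** cadjoint W"
    and B: "B = W ** rdiag (f \<circ> e) ** cadjoint W" by blast
  show "B = U ** rdiag (f \<circ> d) ** cadjoint U"
    unfolding B using hfun_unique[OF assms W] by simp
qed

abbreviation mexp :: "'n::finite cmat \<Rightarrow> 'n cmat" where
  "mexp \<equiv> hfun exp"

text \<open>
  Setting \<open>log 0 = 0\<close> makes \<open>mlog A\<close> vanish on the kernel of \<open>A\<close>, i.e. the logarithm is computed
  on the range of \<open>A\<close>; this also gives \<open>0 log 0 = 0\<close>.
\<close>

definition log0 :: "real \<Rightarrow> real" where
  "log0 x = (if x = 0 then 0 else ln x)"

abbreviation mlog :: "'n::finite cmat \<Rightarrow> 'n cmat" where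
  "mlog \<equiv> hfun log0"

definition tensor :: "'n::finite cmat \<Rightarrow> 'm::finite cmat \<Rightarrow> ('n \<times> 'm) cmat"
    (infixr "\<otimes>\<^sub>m" 75) where
  "A \<otimes>\<^sub>m B = (\<chi> p q. A $ fst p $ fst q * B $ snd p $ snd q)"

definition kronecker_sum :: "'n::finite cmat \<Rightarrow> 'm::finite cmat \<Rightarrow> ('n \<times> 'm) cmat"
    (infixl "\<oplus>\<^sub>m" 65) where
  "U \<oplus>\<^sub>m V = U \<otimes>\<^sub>m mat 1 + mat 1 \<otimes>\<^sub>m V"

definition ptrace1 :: "('n::finite \<times> 'm::finite) cmat \<Rightarrow> 'm cmat" where
  "ptrace1 \<Gamma> = (\<chi> j l. \<Sum>i\<in>UNIV. \<Gamma> $ (i, j) $ (i, l))"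

definition ptrace2 :: "('n::finite \<times> 'm::finite) cmat \<Rightarrow> 'n cmat" where
  "ptrace2 \<Gamma> = (\<chi> i k. \<Sum>j\<in>UNIV. \<Gamma> $ (i, j) $ (k, j))"

text \<open>
  Below, traces are only taken of sums of products of two Hermitian operators; these are real,
  so \<open>Re\<close> only changes the type.
\<close>

definition rtrace :: "'n::finite cmat \<Rightarrow> real" where
  "rtrace A = Re (trace A)"

definition vn_entropy :: "'n::finite cmat \<Rightarrow> real" where
  "vn_entropy \<Gamma> = rtrace (\<Gamma> ** (mlog \<Gamma> - mat 1))"

definition umegaki :: "'n::finite cmat \<Rightarrow> 'n cmat \<Rightarrow> ereal" where
  "umegaki \<gamma>1 \<gamma>2 =
     (if mkernel \<gamma>2 \<subseteq> mkernel \<gamma>1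
      then ereal (rtrace (\<gamma>1 ** (mlog \<gamma>1 - mlog \<gamma>2 - mat 1) + \<gamma>2))
      else \<infinity>)"

definition primal ::
  "real \<Rightarrow> real \<Rightarrow> real \<Rightarrow> ('n::finite \<times> 'm::finite) cmat \<Rightarrow> 'n cmat \<Rightarrow> 'm cmat \<Rightarrow>
   ('n \<times> 'm) cmat \<Rightarrow> ereal" where
  "primal \<epsilon> \<tau>1 \<tau>2 C \<rho> \<sigma> \<Gamma> =
     ereal (rtrace (C ** \<Gamma>) + \<epsilon> * vn_entropy \<Gamma>)
     + ereal \<tau>1 * umegaki (ptrace2 \<Gamma>) \<rho> + ereal \<tau>2 * umegaki (ptrace1 \<Gamma>) \<sigma>"

definition dual ::
  "real \<Rightarrow> real \<Rightarrow> real \<Rightarrow> ('n::finite \<times> 'm::finite) cmat \<Rightarrow> 'n cmat \<Rightarrow> 'm cmat \<Rightarrow>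
   'n cmat \<Rightarrow> 'm cmat \<Rightarrow> real" where
  "dual \<epsilon> \<tau>1 \<tau>2 C \<rho> \<sigma> U V =
     - \<tau>1 * rtrace ((mexp (- (U /\<^sub>R \<tau>1)) - mat 1) ** \<rho>)
     - \<tau>2 * rtrace ((mexp (- (V /\<^sub>R \<tau>2)) - mat 1) ** \<sigma>)
     - \<epsilon> * rtrace (mexp ((U \<oplus>\<^sub>m V - C) /\<^sub>R \<epsilon>))"

end

theory Submission
  imports Defs
begin

text \<open>
  Weak duality splits into three inequalities added together. Klein's inequality (the scalar
  Young inequality \<open>a k \<le> a log a - a + e\<^sup>k\<close> averaged with the doubly stochastic weights of two
  eigenbases) gives \<open>Tr[\<Gamma>K] \<le> S[\<Gamma>] + Tr[e\<^sup>K]\<close> for \<open>K = (U \<oplus> V - C)/\<epsilon>\<close>. For each marginal one needs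
  \<open>Tr[\<gamma>H] \<le> Tr[\<gamma>(log \<gamma> - log \<rho> - Id)] + Tr[e\<^sup>H \<rho>]\<close>. Instead of the Golden-Thompson inequality, the
  proof of the latter shows that measuring in the eigenbasis of \<open>H\<close> decreases the relative
  entropy, after which the scalar Young inequality applies again.

  For that monotonicity, let \<open>\<gamma>\<close> and \<open>\<rho>\<close> have eigenvalues \<open>a\<^sub>i\<close> and \<open>b\<^sub>j\<close> with overlaps \<open>w\<^sub>i\<^sub>j\<close>, and diagonals
  \<open>g\<^sub>k\<close> and \<open>r\<^sub>k\<close> in the eigenbasis of \<open>H\<close>. The function
  \<open>G(s) = \<Sum> w\<^sub>i\<^sub>j a\<^sub>i ln((1-s) b\<^sub>j + s a\<^sub>i) - \<Sum> g\<^sub>k ln((1-s) r\<^sub>k + s g\<^sub>k)\<close> is nondecreasing on \<open>[0,1]\<close>, and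
  \<open>G(0) \<le> G(1)\<close> is the claim. The sign of \<open>G'\<close> follows by completing a square.
\<close>

section \<open>The complex inner product and adjoints\<close>

text \<open>The full Hermitian inner product, conjugate-linear in the first argument. Unitarity
  needs complex orthogonality, while \<open>\<bullet>\<close> sees only the real part.\<close>

definition cip :: "complex ^ 'n \<Rightarrow> complex ^ 'n \<Rightarrow> complex" where
  "cip x y = (\<Sum>i\<in>UNIV. cnj (x $ i) * y $ i)"

lemma Re_cip: "Re (cip x y) = x \<bullet> y"
  by (simp add: cip_def inner_vec_def inner_complex_def)

lemma cip_self: "cip x x = complex_of_real (x \<bullet> x)"
  by (simp add: complex_eq_iff Re_cip) (simp add: cip_def mult.commute)

lemma cip_commute: "cip x y = cnj (cip y x)"
  by (simp add: cip_def mult.commute)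

lemma cip_scale_left: "cip (c *s x) y = cnj c * cip x y"
  by (simp add: cip_def sum_distrib_left mult_ac)

lemma cip_add_right: "cip x (y + z) = cip x y + cip x z"
  by (simp add: cip_def sum.distrib algebra_simps)

lemma cip_scaleR_right: "cip x (r *\<^sub>R y) = r *\<^sub>R cip x y"
  by (simp add: cip_def scaleR_sum_right)

lemma cip_zero_right [simp]: "cip x 0 = 0"
  by (simp add: cip_def)

lemma cadjoint_nth [simp]: "cadjoint A $ i $ j = cnj (A $ j $ i)"
  by (simp add: cadjoint_def map_matrix_def transpose_def)

lemma cadjoint_cadjoint [simp]: "cadjoint (cadjoint A) = A"
  by (simp add: vec_eq_iff)

lemma cadjoint_mult: "cadjoint (A ** B) = cadjoint B ** cadjoint A"
  by (simp add: vec_eq_iff matrix_matrix_mult_def mult.commute)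

lemma cadjoint_rdiag [simp]: "cadjoint (rdiag d) = rdiag d"
  by (auto simp: vec_eq_iff rdiag_def)

lemma hermitian_nth: "hermitian A \<longleftrightarrow> (\<forall>i j. A $ i $ j = cnj (A $ j $ i))"
  by (simp add: hermitian_def vec_eq_iff eq_commute)

lemma cip_matrix_right: "cip x (A *v y) = cip (cadjoint A *v x) y"
proof -
  have "cip x (A *v y) = (\<Sum>i\<in>UNIV. \<Sum>j\<in>UNIV. cnj (x $ i) * A $ i $ j * y $ j)"
    by (simp add: cip_def matrix_vector_mult_def sum_distrib_left mult_ac)
  also have "\<dots> = (\<Sum>j\<in>UNIV. \<Sum>i\<in>UNIV. cnj (x $ i) * A $ i $ j * y $ j)"
    by (rule sum.swap)
  also have "\<dots> = cip (cadjoint A *v x) y"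
    by (simp add: cip_def matrix_vector_mult_def sum_distrib_right sum_distrib_left mult_ac)
  finally show ?thesis .
qed

lemma matrix_vector_scaleR: "A *v (r *\<^sub>R x) = r *\<^sub>R (A *v x)" for A :: "complex ^ 'n ^ 'm"
  by (simp add: vec_eq_iff matrix_vector_mult_def scaleR_sum_right)

section \<open>The spectral theorem for Hermitian matrices\<close>

text \<open>Compactness gives a maximiser of the quadratic form on the unit sphere of
  \<open>W\<close>, and such a maximiser is an eigenvector. Confining the search to an invariant
  \<open>W\<close> lets eigenvectors be split off one at a time.\<close>

lemma hermitian_eigenvector:
  fixes A :: "'n::finite cmat" and W :: "(complex ^ 'n) set"
  assumes herm: "hermitian A" and W: "subspace W" and nz: "w \<in> W" "w \<noteq> 0"
    and inv: "\<And>x. x \<in> W \<Longrightarrow> A *v x \<in> W"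
  obtains x \<mu> where "x \<in> W" "norm x = 1" "A *v x = complex_of_real \<mu> *s x"
proof -
  have sym: "x \<bullet> (A *v y) = (A *v x) \<bullet> y" for x y
    by (metis Re_cip cip_matrix_right herm hermitian_def)
  have "compact (W \<inter> sphere 0 1)"
    using closed_subspace[OF W] by (simp add: closed_Int_compact)
  moreover have "(1 / norm w) *\<^sub>R w \<in> W \<inter> sphere 0 1"
    using nz W by (simp add: subspace_scale)
  moreover have "continuous_on (W \<inter> sphere 0 1) (\<lambda>x. x \<bullet> (A *v x))"
    unfolding matrix_vector_mult_def by (intro continuous_intros)
  ultimately obtain x where x: "x \<in> W" "norm x = 1"
    and max: "\<And>y. y \<in> W \<Longrightarrow> norm y = 1 \<Longrightarrow> y \<bullet> (A *v y) \<le> x \<bullet> (A *v x)"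
    using continuous_attains_sup[of "W \<inter> sphere 0 1" "\<lambda>x. x \<bullet> (A *v x)"]
    by (metis IntE IntI empty_iff mem_sphere_0)
  define \<mu> where "\<mu> = x \<bullet> (A *v x)"
  define B where "B y = \<mu> *\<^sub>R y - A *v y" for y
  have B_ge: "0 \<le> y \<bullet> B y" if y: "y \<in> W" for y
  proof (cases "y = 0")
    case False
    define y' where "y' = (1 / norm y) *\<^sub>R y"
    have "y' \<in> W" "norm y' = 1" using False y W by (auto simp: y'_def subspace_scale)
    then have "y' \<bullet> (A *v y') \<le> \<mu>" using max by (simp add: \<mu>_def)
    moreover have "y' \<bullet> (A *v y') = (y \<bullet> (A *v y)) / (norm y)\<^sup>2"
      by (simp add: y'_def matrix_vector_scaleR power2_eq_square)
    ultimately show ?thesis using False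
      by (simp add: B_def inner_diff_right dot_square_norm divide_le_eq)
  qed (simp add: B_def)
  \<comment> \<open>\<open>B\<close> is positive semi-definite on \<open>W\<close> and \<open>x \<bullet> B x = 0\<close>, so \<open>B x\<close> is orthogonal to \<open>W\<close>;
    it also lies in \<open>W\<close>, hence vanishes.\<close>
  define z where "z = B x"
  have "z \<in> W" using x W inv by (auto simp: z_def B_def subspace_scale subspace_diff)
  have "x \<bullet> z = 0" using x by (simp add: z_def B_def inner_diff_right \<mu>_def dot_square_norm)
  have B_diff: "B (x - t *\<^sub>R z) = z - t *\<^sub>R B z" for t
    by (simp add: B_def z_def matrix_vector_mult_diff_distrib matrix_vector_scaleR algebra_simps)
  have "x \<bullet> B y = B x \<bullet> y" for y
    by (simp add: B_def inner_diff_right inner_diff_left sym)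
  then have xBz: "x \<bullet> B z = z \<bullet> z"
    by (simp add: z_def)
  have quad: "0 \<le> - 2 * t * (z \<bullet> z) + t\<^sup>2 * (z \<bullet> B z)" for t
  proof -
    have "x - t *\<^sub>R z \<in> W" using x \<open>z \<in> W\<close> W by (simp add: subspace_scale subspace_diff)
    from B_ge[OF this] show ?thesis
      unfolding B_diff using \<open>x \<bullet> z = 0\<close> xBz
      by (simp add: inner_diff_right inner_diff_left power2_eq_square algebra_simps)
  qed
  have "z \<bullet> z = 0"
  proof (rule ccontr)
    assume "z \<bullet> z \<noteq> 0"
    then have m: "0 < z \<bullet> z" by (simp add: inner_gt_zero_iff)
    define c where "c = z \<bullet> B z"
    have c: "0 \<le> c" using B_ge[OF \<open>z \<in> W\<close>] by (simp add: c_def)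
    \<comment> \<open>For small positive \<open>t\<close> the linear term of \<open>quad\<close>
      dominates. With this \<open>t\<close>, \<open>t * c\<close> is below
      \<open>z \<bullet> z\<close>, while \<open>quad\<close> would force it to be at least twice
      that; the \<open>+ 1\<close> keeps the denominator positive.\<close>
    define t where "t = z \<bullet> z / (c + 1)"
    have t: "0 < t" "t * (c + 1) = z \<bullet> z" using m c by (auto simp: t_def)
    have "0 \<le> t * (t * c - 2 * (z \<bullet> z))"
      using quad[of t] by (simp add: c_def power2_eq_square algebra_simps)
    then have "2 * (z \<bullet> z) \<le> t * c" using t by (simp add: zero_le_mult_iff)
    then show False using t m by (simp add: algebra_simps)
  qed
  then have "A *v x = \<mu> *\<^sub>R x" by (simp add: z_def B_def)
  moreover have "\<mu> *\<^sub>R x = complex_of_real \<mu> *s x"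
    by (simp add: vec_eq_iff complex_eq_iff)
  ultimately show ?thesis using that x by metis
qed

text \<open>Induction over sets of matrix indices, so that the vectors are already labelled as
  columns. The orthogonal complement of those found so far is invariant because \<open>A\<close> is
  Hermitian, and nonzero by counting dimensions.\<close>

lemma hermitian_orthonormal_eigenvectors:
  fixes A :: "'n::finite cmat" and S :: "'n set"
  assumes "hermitian A"
  shows "\<exists>u d. (\<forall>i\<in>S. A *v u i = complex_of_real (d i) *s u i) \<and>
    (\<forall>i\<in>S. \<forall>j\<in>S. cip (u i) (u j) = (if i = j then 1 else 0))"
  using finite[of S]
proof (induction S rule: finite_induct)
  case (insert k S)
  then obtain u d where eig: "\<And>i. i \<in> S \<Longrightarrow> A *v u i = complex_of_real (d i) *s u i"
    and orth: "\<And>i j. i \<in> S \<Longrightarrow> j \<in> S \<Longrightarrow> cip (u i) (u j) = (if i = j then 1 else 0)"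
    by metis
  define W where "W = {x. \<forall>i\<in>S. cip (u i) x = 0}"
  have W: "subspace W"
    by (auto simp: W_def subspace_def cip_add_right cip_scaleR_right)
  \<comment> \<open>\<open>span\<close> and \<open>dim\<close> are over the reals, where the space
    has dimension twice \<open>CARD('n)\<close>. Real orthogonality to both \<open>u i\<close> and
    \<open>\<i> *s u i\<close> amounts to complex orthogonality to \<open>u i\<close>.\<close>
  define T where "T = u ` S \<union> (\<lambda>i. \<i> *s u i) ` S"
  have "card T \<le> card S + card S"
    unfolding T_def by (rule order_trans[OF card_Un_le]) (intro add_mono card_image_le; simp)
  moreover have "card S < CARD('n)"
    using insert.hyps(2) by (intro psubset_card_mono) auto
  ultimately have "card T < DIM(complex ^ 'n)" by simp
  moreover have "dim T \<le> card T" by (rule dim_le_card') (simp add: T_def)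
  ultimately have "dim T < DIM(complex ^ 'n)" by linarith
  then obtain w where w: "w \<noteq> 0" "\<And>y. y \<in> span T \<Longrightarrow> orthogonal w y"
    using orthogonal_to_subspace_exists[of T] by blast
  have "w \<in> W"
    unfolding W_def
  proof (intro CollectI ballI)
    fix i assume i: "i \<in> S"
    then have "u i \<in> span T" "\<i> *s u i \<in> span T" by (auto simp: T_def intro: span_base)
    then have "u i \<bullet> w = 0" "(\<i> *s u i) \<bullet> w = 0"
      using w(2) by (metis orthogonal_def inner_commute)+
    then have "Re (cip (u i) w) = 0" "Re (cip (\<i> *s u i) w) = 0" by (simp_all only: Re_cip)
    then show "cip (u i) w = 0" by (simp add: cip_scale_left complex_eq_iff)
  qed
  moreover have "A *v x \<in> W" if "x \<in> W" for x
    using that assms by (simp add: W_def cip_matrix_right hermitian_def eig cip_scale_left)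
  ultimately obtain x l where x: "x \<in> W" "norm x = 1" "A *v x = complex_of_real l *s x"
    using hermitian_eigenvector[OF assms W _ w(1)] by metis
  have "cip x x = 1" using x(2) by (simp add: cip_self dot_square_norm)
  moreover have "cip (u i) x = 0" "cip x (u i) = 0" if "i \<in> S" for i
    using x(1) that cip_commute[of x] by (auto simp: W_def)
  moreover have "i \<noteq> k" "k \<noteq> i" if "i \<in> S" for i
    using that insert.hyps(2) by blast+
  ultimately show ?case
    using x(3) eig orth
    by (intro exI[of _ "u(k := x)"] exI[of _ "d(k := l)"]) (simp add: fun_upd_def)
qed simp

theorem hermitian_spectral:
  fixes A :: "'n::finite cmat"
  assumes "hermitian A"
  obtains U d where "unitary U" "A = U ** rdiag d ** cadjoint U"
proof -
  obtain u and d :: "'n \<Rightarrow> real" where "\<forall>i\<in>UNIV. A *v u i = complex_of_real (d i) *s u i"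
    and "\<forall>i\<in>UNIV. \<forall>j\<in>UNIV. cip (u i) (u j) = (if i = j then 1 else 0)"
    using hermitian_orthonormal_eigenvectors[OF assms, of UNIV] by blast
  then have eig: "A *v u i = complex_of_real (d i) *s u i"
    and orth: "cip (u i) (u j) = (if i = j then 1 else 0)" for i j
    by simp_all
  define U :: "'n cmat" where "U = (\<chi> i j. u j $ i)"
  have "cadjoint U ** U = mat 1"
    using orth by (simp add: vec_eq_iff matrix_matrix_mult_def U_def cip_def mat_def)
  then have U: "cadjoint U ** U = mat 1" "U ** cadjoint U = mat 1"
    using matrix_left_right_inverse by blast+
  have "(A ** U) $ i $ j = (U ** rdiag d) $ i $ j" for i j
  proof -
    have "(A ** U) $ i $ j = (A *v u j) $ i"
      by (simp add: matrix_matrix_mult_def matrix_vector_mult_def U_def)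
    then show ?thesis by (simp add: eig rdiag_mult_right U_def mult.commute)
  qed
  then have "A ** U = U ** rdiag d" by (simp add: vec_eq_iff)
  then have "A = U ** rdiag d ** cadjoint U"
    by (metis U(2) matrix_mul_assoc matrix_mul_rid)
  with U show ?thesis using that by (simp add: unitary_def)
qed

section \<open>Traces and unitary diagonalisations\<close>

lemma rtrace_add: "rtrace (A + B) = rtrace A + rtrace B"
  by (simp add: rtrace_def trace_add)

lemma rtrace_diff: "rtrace (A - B) = rtrace A - rtrace B"
  by (simp add: rtrace_def trace_sub)

lemma rtrace_scaleR: "rtrace (c *\<^sub>R A) = c * rtrace A"
  by (simp add: rtrace_def trace_def sum_distrib_left)

lemma rtrace_commute: "rtrace (A ** B) = rtrace (B ** A)"
  unfolding rtrace_def by (subst trace_mul_sym) (rule refl)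

lemma matrix_mult_scaleR_right: "A ** (c *\<^sub>R B) = c *\<^sub>R (A ** B)"
  for A :: "complex ^ 'n ^ 'm"
  by (simp add: matrix_scalar_ac scalar_matrix_assoc)

lemma matrix_mult_diff_right: "A ** (B - C) = A ** B - A ** C"
  for A :: "complex ^ 'n ^ 'm"
  by (simp add: vec_eq_iff matrix_matrix_mult_def sum_subtractf algebra_simps)

lemma matrix_mult_diff_left: "(A - B) ** C = A ** C - B ** C"
  for A :: "complex ^ 'n ^ 'm"
  by (simp add: vec_eq_iff matrix_matrix_mult_def sum_subtractf algebra_simps)

text \<open>Real inner products of entries give squared moduli when \<open>M = N\<close>, and for
  \<open>M \<noteq> N\<close> the cross terms needed later to complete a square.\<close>

lemma rtrace_rdiag_mult:
  "rtrace (rdiag a ** (cadjoint M ** N)) = (\<Sum>i\<in>UNIV. \<Sum>j\<in>UNIV. a i * ((M $ j $ i) \<bullet> (N $ j $ i)))"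
  unfolding rtrace_def trace_def rdiag_mult_left
  by (simp add: matrix_matrix_mult_def sum_distrib_left inner_complex_def)

lemma rtrace_diagonalised_mult:
  "rtrace ((U ** rdiag a ** cadjoint U) ** B) = rtrace (rdiag a ** (cadjoint U ** B ** U))"
  by (metis matrix_mul_assoc rtrace_commute)

text \<open>By cyclicity only the overlap matrix \<open>cadjoint V ** U\<close> matters. For unitary
  \<open>U\<close> and \<open>V\<close> its squared moduli form a doubly stochastic matrix.\<close>

lemma rtrace_spectral_mult:
  "rtrace ((U ** rdiag a ** cadjoint U) ** (V ** rdiag b ** cadjoint V)) =
    (\<Sum>i\<in>UNIV. \<Sum>j\<in>UNIV. a i * b j * (cmod ((cadjoint V ** U) $ j $ i))\<^sup>2)"
proof -
  have "rtrace ((U ** rdiag a ** cadjoint U) ** (V ** rdiag b ** cadjoint V)) =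
      rtrace (rdiag a ** (cadjoint (cadjoint V ** U) ** (rdiag b ** (cadjoint V ** U))))"
    by (subst rtrace_diagonalised_mult)
      (simp only: cadjoint_mult cadjoint_cadjoint matrix_mul_assoc)
  also have "\<dots> = (\<Sum>i\<in>UNIV. \<Sum>j\<in>UNIV. a i * b j * (cmod ((cadjoint V ** U) $ j $ i))\<^sup>2)"
    unfolding rtrace_rdiag_mult
    by (intro sum.cong refl)
      (simp add: rdiag_mult_left power2_norm_eq_inner scaleR_conv_of_real[symmetric])
  finally show ?thesis .
qed

lemma unitary_cadjoint: "unitary U \<Longrightarrow> unitary (cadjoint U)"
  by (simp add: unitary_def)

lemma unitary_cancel:
  fixes A :: "complex ^ 'n ^ 'm"
  assumes "unitary U"
  shows "A ** U ** cadjoint U = A" "A ** cadjoint U ** U = A"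
  using assms by (simp_all add: unitary_def matrix_mul_assoc[symmetric] matrix_mul_rid)

lemma unitary_mult: "unitary U \<Longrightarrow> unitary V \<Longrightarrow> unitary (U ** V)"
  unfolding unitary_def cadjoint_mult by (metis matrix_mul_assoc matrix_mul_rid)

lemma unitary_col_sum:
  assumes "unitary U"
  shows "(\<Sum>j\<in>UNIV. (cmod (U $ j $ i))\<^sup>2) = 1"
proof -
  have "complex_of_real (\<Sum>j\<in>UNIV. (cmod (U $ j $ i))\<^sup>2) = (cadjoint U ** U) $ i $ i"
    by (simp add: matrix_matrix_mult_def complex_norm_square mult.commute del: of_real_power)
  also have "\<dots> = complex_of_real 1" using assms by (simp add: unitary_def mat_def)
  finally show ?thesis by (simp only: of_real_eq_iff)
qed

lemma unitary_row_sum: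
  assumes "unitary U"
  shows "(\<Sum>i\<in>UNIV. (cmod (U $ j $ i))\<^sup>2) = 1"
  using unitary_col_sum[OF unitary_cadjoint[OF assms], of j] by simp

lemma rtrace_rdiag: "rtrace (rdiag a) = sum a UNIV"
  by (simp add: rtrace_def trace_def rdiag_def)

lemma rtrace_diagonalised:
  "unitary U \<Longrightarrow> rtrace (U ** rdiag a ** cadjoint U) = sum a UNIV"
  by (metis matrix_mul_assoc matrix_mul_rid rtrace_commute rtrace_rdiag unitary_def)

lemma diagonalised_mult:
  assumes "unitary U"
  shows "(U ** rdiag a ** cadjoint U) ** (U ** rdiag b ** cadjoint U) =
    U ** rdiag (\<lambda>i. a i * b i) ** cadjoint U"
proof -
  have "rdiag a ** rdiag b = rdiag (\<lambda>i. a i * b i)"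
    by (simp add: vec_eq_iff rdiag_mult_left) (simp add: rdiag_def)
  then have "U ** rdiag a ** rdiag b = U ** rdiag (\<lambda>i. a i * b i)"
    by (simp add: matrix_mul_assoc[symmetric])
  then show ?thesis using assms by (simp add: matrix_mul_assoc unitary_cancel)
qed

lemma hermitian_diagonalised: "hermitian (U ** rdiag a ** cadjoint U)"
  by (simp add: hermitian_def cadjoint_mult matrix_mul_assoc)

text \<open>The columns of \<open>U\<close> are unit eigenvectors, so positivity of the form passes
  to the eigenvalues.\<close>

lemma diagonalised_quadratic_form:
  assumes "unitary U"
  shows "column i U \<bullet> ((U ** rdiag d ** cadjoint U) *v column i U) = d i"
proof -
  let ?A = "U ** rdiag d ** cadjoint U"
  have "?A ** U = U ** rdiag d"
    using assms by (simp add: unitary_cancel)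
  then have "(?A *v column i U) $ k = complex_of_real (d i) * U $ k $ i" for k
    using rdiag_mult_right[of U d k i]
    by (simp add: matrix_vector_mult_def matrix_matrix_mult_def column_def mult.commute vec_eq_iff)
  then have "?A *v column i U = d i *\<^sub>R column i U"
    by (simp add: vec_eq_iff column_def complex_eq_iff)
  moreover have "column i U \<bullet> column i U = 1"
    using unitary_col_sum[OF assms, of i] by (simp add: inner_vec_def column_def dot_square_norm)
  ultimately show ?thesis by simp
qed

lemma psd_spectral:
  assumes "psd A"
  obtains U d where "unitary U" "A = U ** rdiag d ** cadjoint U" "\<And>i. 0 \<le> d i"
proof -
  obtain U d where U: "unitary U" "A = U ** rdiag d ** cadjoint U"
    using assms hermitian_spectral by (metis psd_def)
  have "0 \<le> d i" for i
    using assms diagonalised_quadratic_form[OF U(1)] U(2) by (metis psd_def)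
  with U that show ?thesis by blast
qed

lemma posdef_spectral:
  assumes "posdef A"
  obtains U d where "unitary U" "A = U ** rdiag d ** cadjoint U" "\<And>i. 0 < d i"
proof -
  obtain U d where U: "unitary U" "A = U ** rdiag d ** cadjoint U"
    using assms hermitian_spectral by (metis posdef_def)
  have "0 < d i" for i
  proof -
    have "column i U \<noteq> 0"
    proof
      assume "column i U = 0"
      then have "U $ j $ i = 0" for j by (simp add: column_def vec_eq_iff)
      then show False using unitary_col_sum[OF U(1), of i] by simp
    qed
    then show ?thesis
      using assms diagonalised_quadratic_form[OF U(1)] U(2) by (metis posdef_def)
  qed
  with U that show ?thesis by blast
qed

section \<open>Entropy inequalities\<close>

text \<open>For \<open>a > 0\<close> this is \<open>1 + t \<le> exp t\<close> at
  \<open>t = k - ln a\<close>, multiplied by \<open>a\<close>; for \<open>a = 0\<close> it reads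
  \<open>0 \<le> exp k\<close>.\<close>

lemma entropy_exp_Young:
  assumes "0 \<le> (a::real)"
  shows "a * k \<le> a * log0 a - a + exp k"
proof (cases "a = 0")
  case False
  with assms have a: "0 < a" by simp
  have "1 + (k - ln a) \<le> exp (k - ln a)" by (rule exp_ge_add_one_self)
  then have "a * (1 + (k - ln a)) \<le> a * exp (k - ln a)" using a by simp
  also have "a * exp (k - ln a) = exp k" using a by (simp add: exp_diff)
  finally show ?thesis using a by (simp add: log0_def algebra_simps)
qed simp

text \<open>Unit row sums of the weights collapse the terms in \<open>a\<close> alone to the
  entropy, and unit column sums collapse the exponentials to \<open>rtrace (mexp K)\<close>.\<close>

lemma Klein_inequality_exp:
  assumes A: "psd A" and K: "hermitian K"
  shows "rtrace (A ** K) \<le> vn_entropy A + rtrace (mexp K)"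
proof -
  obtain U a where U: "unitary U" and A_eq: "A = U ** rdiag a ** cadjoint U" and a: "\<And>i. 0 \<le> a i"
    using psd_spectral[OF A] by blast
  obtain V k where V: "unitary V" and K_eq: "K = V ** rdiag k ** cadjoint V"
    using hermitian_spectral[OF K] by blast
  define w where "w i j = (cmod ((cadjoint V ** U) $ j $ i))\<^sup>2" for i j
  have VU: "unitary (cadjoint V ** U)" using U V by (simp add: unitary_mult unitary_cadjoint)
  have row: "(\<Sum>j\<in>UNIV. w i j) = 1" for i
    unfolding w_def by (rule unitary_col_sum[OF VU])
  have col: "(\<Sum>i\<in>UNIV. w i j) = 1" for j
    unfolding w_def by (rule unitary_row_sum[OF VU])
  have "rtrace (A ** K) = (\<Sum>i\<in>UNIV. \<Sum>j\<in>UNIV. w i j * (a i * k j))"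
    unfolding A_eq K_eq rtrace_spectral_mult w_def by (simp add: mult_ac)
  also have "\<dots> \<le> (\<Sum>i\<in>UNIV. \<Sum>j\<in>UNIV. w i j * (a i * log0 (a i) - a i + exp (k j)))"
    by (intro sum_mono mult_left_mono entropy_exp_Young a) (simp add: w_def)
  also have "\<dots> = (\<Sum>i\<in>UNIV. \<Sum>j\<in>UNIV. w i j * (a i * log0 (a i) - a i))
      + (\<Sum>i\<in>UNIV. \<Sum>j\<in>UNIV. w i j * exp (k j))"
    by (simp add: sum.distrib distrib_left)
  also have "(\<Sum>i\<in>UNIV. \<Sum>j\<in>UNIV. w i j * (a i * log0 (a i) - a i))
      = (\<Sum>i\<in>UNIV. a i * log0 (a i) - a i)"
    by (simp add: sum_distrib_right[symmetric] row)
  also have "(\<Sum>i\<in>UNIV. \<Sum>j\<in>UNIV. w i j * exp (k j)) = (\<Sum>j\<in>UNIV. exp (k j))"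
    by (subst sum.swap) (simp add: sum_distrib_right[symmetric] col)
  also have "(\<Sum>j\<in>UNIV. exp (k j)) = rtrace (mexp K)"
    unfolding K_eq hfun_eq[OF V] rtrace_diagonalised[OF V] by simp
  also have "(\<Sum>i\<in>UNIV. a i * log0 (a i) - a i) = vn_entropy A"
    unfolding vn_entropy_def matrix_mult_diff_right rtrace_diff matrix_mul_rid A_eq
      hfun_eq[OF U] diagonalised_mult[OF U] rtrace_diagonalised[OF U]
    by (simp add: sum_subtractf)
  finally show ?thesis .
qed

text \<open>\<open>H\<close> and \<open>mlog \<rho>\<close> need not commute, so Klein's inequality
  for their sum would leave the exponential of that sum instead of \<open>mexp H ** \<rho>\<close>.
  Passing to diagonals in the eigenbasis of \<open>H\<close> reduces the exponential to
  scalars.\<close>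

lemma relative_entropy_exp_bound:
  fixes \<gamma> \<rho> H :: "'n::finite cmat"
  assumes \<gamma>: "psd \<gamma>" and \<rho>: "posdef \<rho>" and H: "hermitian H"
  shows "rtrace (\<gamma> ** H) \<le> rtrace (\<gamma> ** (mlog \<gamma> - mlog \<rho> - mat 1)) + rtrace (mexp H ** \<rho>)"
proof -
  obtain P a where P: "unitary P" and \<gamma>_eq: "\<gamma> = P ** rdiag a ** cadjoint P" and a: "\<And>i. 0 \<le> a i"
    using psd_spectral[OF \<gamma>] by blast
  obtain Q b where Q: "unitary Q" and \<rho>_eq: "\<rho> = Q ** rdiag b ** cadjoint Q" and b: "\<And>i. 0 < b i"
    using posdef_spectral[OF \<rho>] by blast
  obtain R h where R: "unitary R" and H_eq: "H = R ** rdiag h ** cadjoint R"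
    using hermitian_spectral[OF H] by blast
  have PQR: "unitary (cadjoint Q ** P)" "unitary (cadjoint R ** P)" "unitary (cadjoint R ** Q)"
    using P Q R by (simp_all add: unitary_mult unitary_cadjoint)
  define w where "w i j = (cmod ((cadjoint Q ** P) $ j $ i))\<^sup>2" for i j
  define g where "g k = (\<Sum>i\<in>UNIV. a i * (cmod ((cadjoint R ** P) $ k $ i))\<^sup>2)" for k
  define r where "r k = (\<Sum>j\<in>UNIV. b j * (cmod ((cadjoint R ** Q) $ k $ j))\<^sup>2)" for k
  have w: "0 \<le> w i j" for i j by (simp add: w_def)
  have w_row: "(\<Sum>j\<in>UNIV. w i j) = 1" for i
    unfolding w_def by (rule unitary_col_sum[OF PQR(1)])
  have g: "0 \<le> g k" for k using a by (auto simp: g_def intro!: sum_nonneg)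
  have r: "0 < r k" for k
  proof -
    have "\<exists>j. (cadjoint R ** Q) $ k $ j \<noteq> 0"
      using unitary_row_sum[OF PQR(3), of k] by (rule contrapos_pp) simp
    then obtain j where "(cadjoint R ** Q) $ k $ j \<noteq> 0" by blast
    then show ?thesis unfolding r_def
      using b by (intro sum_pos2[where i = j]) (auto simp: less_imp_le)
  qed
  \<comment> \<open>Operators diagonal in the eigenbasis of \<open>H\<close> see \<gamma> only
    through \<open>g\<close>. The diagonal \<open>y\<close> stays arbitrary: it will be
    \<open>h\<close> as well as the test weights and their squares.\<close>
  have tr_\<gamma>: "rtrace (\<gamma> ** (R ** rdiag y ** cadjoint R)) = (\<Sum>k\<in>UNIV. g k * y k)" for y
    unfolding \<gamma>_eq rtrace_spectral_mult g_def sum_distrib_right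
    by (subst sum.swap) (simp add: mult_ac)
  have tr_\<rho>: "rtrace (\<rho> ** (R ** rdiag y ** cadjoint R)) = (\<Sum>k\<in>UNIV. r k * y k)" for y
    unfolding \<rho>_eq rtrace_spectral_mult r_def sum_distrib_right
    by (subst sum.swap) (simp add: mult_ac)
  have sum_g: "(\<Sum>k\<in>UNIV. g k) = (\<Sum>i\<in>UNIV. a i)"
    unfolding g_def
    by (subst sum.swap) (simp add: sum_distrib_left[symmetric] unitary_col_sum[OF PQR(2)])

  \<comment> \<open>Testing with \<open>Y = \<Sum> y\<^sub>k |k\<rangle>\<langle>k|\<close>, \<open>y\<^sub>k = g\<^sub>k / E\<^sub>k\<close>, attains the left-hand side in
    \<open>2 Tr[\<gamma>Y] - Tr[((1-s) \<rho> + s \<gamma>) Y\<^sup>2]\<close>; expanding the same traces in the eigenbases of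
    \<open>\<gamma>\<close> and \<open>\<rho>\<close> bounds this by the right-hand side.\<close>
  have resolvent: "(\<Sum>k\<in>UNIV. (g k)\<^sup>2 / ((1 - s) * r k + s * g k))
      \<le> (\<Sum>i\<in>UNIV. \<Sum>j\<in>UNIV. w i j * ((a i)\<^sup>2 / ((1 - s) * b j + s * a i)))"
    if s: "0 < s" "s < 1" for s
  proof -
    \<comment> \<open>\<open>D i j\<close> is the eigenvalue of
      \<open>X \<mapsto> (1 - s) \<rho> X + s X \<gamma>\<close> at the rank-one operator built from
      column \<open>j\<close> of \<open>Q\<close> and column \<open>i\<close> of \<open>P\<close>.
      \<open>E k\<close> is a diagonal entry of \<open>(1 - s) \<rho> + s \<gamma>\<close> in the
      eigenbasis of \<open>H\<close>.\<close>
    define D where "D i j = (1 - s) * b j + s * a i" for i j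
    define E where "E k = (1 - s) * r k + s * g k" for k
    have D: "0 < D i j" for i j using s a b by (simp add: D_def add_pos_nonneg)
    have E: "0 < E k" for k using s g r by (simp add: E_def add_pos_nonneg)
    define y where "y k = g k / E k" for k
    define Y where "Y = R ** rdiag y ** cadjoint R"
    define p where "p = cadjoint Q ** P"
    \<comment> \<open>The matrix of \<open>Y\<close> from the eigenbasis of \<gamma> to that of
      \<rho>. All three traces become sums over its entries, which can then be compared pair by
      pair.\<close>
    define N where "N = cadjoint Q ** Y ** P"
    have YY: "Y ** Y = R ** rdiag (\<lambda>k. (y k)\<^sup>2) ** cadjoint R"
      unfolding Y_def diagonalised_mult[OF R] by (simp add: power2_eq_square)
    have Y_herm: "cadjoint Y = Y"
      using hermitian_diagonalised unfolding Y_def hermitian_def .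
    have \<gamma>Y: "rtrace (\<gamma> ** Y) = (\<Sum>i\<in>UNIV. \<Sum>j\<in>UNIV. a i * (p $ j $ i \<bullet> N $ j $ i))"
    proof -
      have "cadjoint P ** Y ** P = cadjoint p ** N"
        unfolding p_def N_def cadjoint_mult cadjoint_cadjoint
        by (simp add: matrix_mul_assoc unitary_cancel[OF Q])
      then show ?thesis unfolding \<gamma>_eq rtrace_diagonalised_mult by (simp add: rtrace_rdiag_mult)
    qed
    have \<gamma>YY: "rtrace (\<gamma> ** (Y ** Y)) = (\<Sum>i\<in>UNIV. \<Sum>j\<in>UNIV. a i * (N $ j $ i \<bullet> N $ j $ i))"
    proof -
      have "cadjoint P ** (Y ** Y) ** P = cadjoint N ** N"
        unfolding N_def cadjoint_mult cadjoint_cadjoint Y_herm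
        by (simp add: matrix_mul_assoc unitary_cancel[OF Q])
      then show ?thesis unfolding \<gamma>_eq rtrace_diagonalised_mult by (simp add: rtrace_rdiag_mult)
    qed
    have \<rho>YY: "rtrace (\<rho> ** (Y ** Y)) = (\<Sum>i\<in>UNIV. \<Sum>j\<in>UNIV. b j * (N $ j $ i \<bullet> N $ j $ i))"
    proof -
      \<comment> \<open>Seen from the eigenbasis of \<rho> the roles of \<open>P\<close> and
        \<open>Q\<close> are exchanged, hence \<open>cadjoint N\<close>.\<close>
      have "cadjoint Q ** (Y ** Y) ** Q = cadjoint (cadjoint N) ** cadjoint N"
        unfolding N_def cadjoint_mult cadjoint_cadjoint Y_herm
        by (simp add: matrix_mul_assoc unitary_cancel[OF P])
      then have "rtrace (\<rho> ** (Y ** Y)) =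
          (\<Sum>j\<in>UNIV. \<Sum>i\<in>UNIV. b j * (N $ j $ i \<bullet> N $ j $ i))"
        unfolding \<rho>_eq rtrace_diagonalised_mult
        by (simp only: rtrace_rdiag_mult) (simp add: inner_complex_def)
      then show ?thesis by (subst sum.swap)
    qed
    have "(\<Sum>k\<in>UNIV. (g k)\<^sup>2 / E k) =
        (\<Sum>k\<in>UNIV. 2 * (g k * y k) - (1 - s) * (r k * (y k)\<^sup>2) - s * (g k * (y k)\<^sup>2))"
    proof (intro sum.cong refl)
      fix k
      have "2 * (g k * y k) - (1 - s) * (r k * (y k)\<^sup>2) - s * (g k * (y k)\<^sup>2) =
          2 * (g k * y k) - E k * (y k)\<^sup>2"
        by (simp add: E_def algebra_simps)
      also have "\<dots> = (g k)\<^sup>2 / E k"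
        using E[of k] by (simp add: y_def power2_eq_square)
      finally show "(g k)\<^sup>2 / E k = 2 * (g k * y k) - (1 - s) * (r k * (y k)\<^sup>2) - s * (g k * (y k)\<^sup>2)" ..
    qed
    also have "\<dots> =
        2 * rtrace (\<gamma> ** Y) - (1 - s) * rtrace (\<rho> ** (Y ** Y)) - s * rtrace (\<gamma> ** (Y ** Y))"
      unfolding YY tr_\<gamma> tr_\<rho> unfolding Y_def tr_\<gamma> by (simp add: sum_subtractf sum_distrib_left)
    also have "\<dots> =
        (\<Sum>i\<in>UNIV. \<Sum>j\<in>UNIV. 2 * a i * (p $ j $ i \<bullet> N $ j $ i) - D i j * (N $ j $ i \<bullet> N $ j $ i))"
      unfolding \<gamma>Y \<gamma>YY \<rho>YY
      by (simp add: D_def sum_subtractf sum_distrib_left sum.distrib algebra_simps)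
    also have "\<dots> \<le> (\<Sum>i\<in>UNIV. \<Sum>j\<in>UNIV. w i j * ((a i)\<^sup>2 / D i j))"
    proof (intro sum_mono)
      fix i j
      let ?p = "p $ j $ i" and ?N = "N $ j $ i"
      \<comment> \<open>The square to complete: \<open>?z \<bullet> ?z \<ge> 0\<close> divided by
        \<open>D i j\<close> is the required inequality.\<close>
      let ?z = "a i *\<^sub>R ?p - D i j *\<^sub>R ?N"
      have w_p: "w i j = ?p \<bullet> ?p"
        by (simp add: w_def p_def power2_norm_eq_inner)
      have "0 \<le> (?z \<bullet> ?z) / D i j" using D[of i j] by simp
      also have "?z \<bullet> ?z = (a i)\<^sup>2 * w i j - D i j * (2 * a i * (?p \<bullet> ?N) - D i j * (?N \<bullet> ?N))"
        by (simp add: w_p inner_diff_left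
            inner_diff_right inner_commute power2_eq_square algebra_simps)
      finally show "2 * a i * (?p \<bullet> ?N) - D i j * (?N \<bullet> ?N) \<le> w i j * ((a i)\<^sup>2 / D i j)"
        using D[of i j] by (simp add: diff_divide_distrib mult.commute)
    qed
    finally show ?thesis unfolding D_def E_def .
  qed

  define G where "G s = (\<Sum>i\<in>UNIV. \<Sum>j\<in>UNIV. w i j * (a i * ln ((1 - s) * b j + s * a i)))
      - (\<Sum>k\<in>UNIV. g k * ln ((1 - s) * r k + s * g k))" for s
  \<comment> \<open>The derivative \<open>x * (x - c) / d\<close>, with \<open>d\<close> the
    argument of the logarithm, is rewritten through \<open>x - d = (1 - s) * (x - c)\<close> to
    exhibit the quotients of \<open>resolvent\<close>.\<close>
  have scalar_deriv: "((\<lambda>s. x * ln ((1 - s) * c + s * x)) has_real_derivative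
      (x\<^sup>2 / ((1 - s) * c + s * x) - x) / (1 - s)) (at s)"
    if "0 < s" "s < 1" "0 \<le> x" "0 < c" for x c s :: real
  proof -
    define d where "d = (1 - s) * c + s * x"
    have d: "0 < d" using that by (simp add: d_def add_pos_nonneg)
    have "x - d = (1 - s) * (x - c)" by (simp add: d_def algebra_simps)
    then have xc: "x - c = (x - d) / (1 - s)" using that by simp
    have xd: "x\<^sup>2 / d - x = x * ((x - d) / d)"
      using d by (simp add: field_simps power2_eq_square)
    have "x * ((x - c) / d) = (x\<^sup>2 / d - x) / (1 - s)"
      unfolding xc xd by (simp add: mult.commute)
    moreover have "((\<lambda>s. x * ln ((1 - s) * c + s * x)) has_real_derivative x * ((x - c) / d)) (at s)"
      using d by (auto intro!: derivative_eq_intros simp: d_def)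
    ultimately show ?thesis by (simp add: d_def)
  qed
  \<comment> \<open>The argument of \<open>ln\<close> vanishes only at \<open>s = 1\<close> with
    \<open>x = 0\<close>; there the factor \<open>x\<close> makes the whole function constantly
    zero.\<close>
  have scalar_cont: "continuous_on {0..1} (\<lambda>s. x * ln ((1 - s) * c + s * x))"
    if "0 \<le> x" "0 < c" for x c :: real
  proof (cases "x = 0")
    case False
    have "(1 - s) * c + s * x \<noteq> 0" if "s \<in> {0..1}" for s
    proof (cases "s = 1")
      case False
      with that \<open>0 \<le> x\<close> \<open>0 < c\<close> have "0 < (1 - s) * c + s * x" by (simp add: add_pos_nonneg)
      then show ?thesis by simp
    qed (use \<open>x \<noteq> 0\<close> in simp)
    then show ?thesis by (auto intro!: continuous_intros)
  qed simp
  have "G 0 \<le> G 1"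
  \<comment> \<open>A singular \<gamma> can make the logarithms degenerate at \<open>s = 1\<close>,
    so derivatives are taken in the open interval and continuity covers the endpoints.\<close>
  proof (rule DERIV_nonneg_imp_increasing_open[of 0 1 G])
    fix s :: real assume s: "0 < s" "s < 1"
    let ?G' = "(\<Sum>i\<in>UNIV. \<Sum>j\<in>UNIV. w i j * (((a i)\<^sup>2 / ((1 - s) * b j + s * a i) - a i) / (1 - s)))
        - (\<Sum>k\<in>UNIV. ((g k)\<^sup>2 / ((1 - s) * r k + s * g k) - g k) / (1 - s))"
    have "(G has_real_derivative ?G') (at s)"
      unfolding G_def by (intro DERIV_diff DERIV_sum DERIV_cmult scalar_deriv s a b g r)
    moreover have "?G' = ((\<Sum>i\<in>UNIV. \<Sum>j\<in>UNIV. w i j * ((a i)\<^sup>2 / ((1 - s) * b j + s * a i)))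
        - (\<Sum>k\<in>UNIV. (g k)\<^sup>2 / ((1 - s) * r k + s * g k))) / (1 - s)"
    proof -
      \<comment> \<open>Both sides are the trace of \<gamma>, so the linear terms of the derivative
        cancel.\<close>
      have "(\<Sum>i\<in>UNIV. \<Sum>j\<in>UNIV. w i j * a i) = (\<Sum>k\<in>UNIV. g k)"
        by (simp add: sum_distrib_right[symmetric] w_row sum_g)
      then show ?thesis
        by (simp add: diff_divide_distrib[symmetric] sum_divide_distrib[symmetric]
              right_diff_distrib sum_subtractf)
    qed
    ultimately show "\<exists>y. (G has_real_derivative y) (at s) \<and> 0 \<le> y"
      using resolvent[OF s] s by (intro exI[of _ ?G']) simp
  next
    show "continuous_on {0..1} G"
      unfolding G_def
      by (intro continuous_on_diff continuous_on_sum continuous_on_mult_left scalar_cont a b g r)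
  qed simp
  then have mono: "(\<Sum>i\<in>UNIV. \<Sum>j\<in>UNIV. w i j * (a i * ln (b j))) - (\<Sum>k\<in>UNIV. g k * ln (r k))
      \<le> (\<Sum>i\<in>UNIV. a i * ln (a i)) - (\<Sum>k\<in>UNIV. g k * ln (g k))"
    by (simp add: G_def sum_distrib_right[symmetric] w_row)

  have log0_ln: "x * log0 x = x * ln x" for x by (simp add: log0_def)
  have "rtrace (\<gamma> ** mlog \<gamma>) = (\<Sum>i\<in>UNIV. a i * ln (a i))"
    unfolding \<gamma>_eq hfun_eq[OF P] diagonalised_mult[OF P] rtrace_diagonalised[OF P]
    by (simp add: log0_ln)
  moreover have "rtrace (\<gamma> ** mlog \<rho>) = (\<Sum>i\<in>UNIV. \<Sum>j\<in>UNIV. w i j * (a i * ln (b j)))"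
    unfolding \<gamma>_eq \<rho>_eq hfun_eq[OF Q] rtrace_spectral_mult
    using b by (simp add: w_def log0_def less_imp_neq[symmetric] mult_ac)
  moreover have "rtrace \<gamma> = (\<Sum>k\<in>UNIV. g k)"
    unfolding \<gamma>_eq rtrace_diagonalised[OF P] sum_g ..
  moreover have "rtrace (\<gamma> ** H) = (\<Sum>k\<in>UNIV. g k * h k)"
    unfolding H_eq by (rule tr_\<gamma>)
  moreover have "rtrace (mexp H ** \<rho>) = (\<Sum>k\<in>UNIV. r k * exp (h k))"
    unfolding H_eq hfun_eq[OF R] by (subst rtrace_commute) (simp add: tr_\<rho>)
  \<comment> \<open>The scalar case: shifting the exponent by \<open>ln (r k)\<close> turns the
    exponential in Young's inequality into \<open>r k * exp (h k)\<close>.\<close>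
  moreover have "(\<Sum>k\<in>UNIV. g k * (h k + ln (r k))) \<le>
      (\<Sum>k\<in>UNIV. g k * ln (g k) - g k + r k * exp (h k))"
  proof (rule sum_mono)
    fix k
    show "g k * (h k + ln (r k)) \<le> g k * ln (g k) - g k + r k * exp (h k)"
      using entropy_exp_Young[OF g, of k "h k + ln (r k)"] r[of k]
      by (simp add: log0_ln exp_add mult.commute)
  qed
  ultimately show ?thesis
    using mono
    by (simp add: matrix_mult_diff_right rtrace_diff sum.distrib sum_subtractf distrib_left)
qed

section \<open>Partial traces\<close>

lemma sum_UNIV_prod: "(\<Sum>p\<in>UNIV. f p) = (\<Sum>i\<in>UNIV. \<Sum>j\<in>UNIV. f (i, j))"
  for f :: "'n::finite \<times> 'm::finite \<Rightarrow> 'a::comm_monoid_add"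
  by (simp add: UNIV_Times_UNIV[symmetric] sum.cartesian_product del: UNIV_Times_UNIV)

text \<open>Tracing out the second factor is dual to tensoring with the identity there; this is how
  the potentials come to act on the marginals.\<close>

lemma rtrace_tensor_mat1: "rtrace (\<Gamma> ** (U \<otimes>\<^sub>m mat 1)) = rtrace (ptrace2 \<Gamma> ** U)"
proof -
  have "trace (\<Gamma> ** (U \<otimes>\<^sub>m mat 1)) = (\<Sum>i\<in>UNIV. \<Sum>j\<in>UNIV. \<Sum>k\<in>UNIV. \<Gamma> $ (i, j) $ (k, j) * U $ k $ i)"
    by (simp add: trace_def matrix_matrix_mult_def sum_UNIV_prod tensor_def mat_def
        if_distrib[of "\<lambda>x. _ * x"] cong: if_cong)
  also have "\<dots> = (\<Sum>i\<in>UNIV. \<Sum>k\<in>UNIV. \<Sum>j\<in>UNIV. \<Gamma> $ (i, j) $ (k, j) * U $ k $ i)"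
    by (intro sum.cong refl sum.swap)
  also have "\<dots> = trace (ptrace2 \<Gamma> ** U)"
    by (simp add: trace_def matrix_matrix_mult_def ptrace2_def sum_distrib_right)
  finally show ?thesis by (simp add: rtrace_def)
qed

lemma rtrace_mat1_tensor: "rtrace (\<Gamma> ** (mat 1 \<otimes>\<^sub>m V)) = rtrace (ptrace1 \<Gamma> ** V)"
proof -
  have "trace (\<Gamma> ** (mat 1 \<otimes>\<^sub>m V)) = (\<Sum>i\<in>UNIV. \<Sum>j\<in>UNIV. \<Sum>l\<in>UNIV. \<Gamma> $ (i, j) $ (i, l) * V $ l $ j)"
  proof -
    have "(\<Sum>k\<in>UNIV. \<Sum>l\<in>UNIV. \<Gamma> $ (i, j) $ (k, l) * ((if k = i then 1 else 0) * V $ l $ j))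
        = (\<Sum>l\<in>UNIV. \<Gamma> $ (i, j) $ (i, l) * V $ l $ j)" for i j
      by (subst sum.swap) (simp add: if_distrib[of "\<lambda>x. _ * x"]
          if_distrib[of "\<lambda>x. x * _"] cong: if_cong)
    then show ?thesis
      by (simp add: trace_def matrix_matrix_mult_def sum_UNIV_prod tensor_def mat_def)
  qed
  also have "\<dots> = (\<Sum>j\<in>UNIV. \<Sum>l\<in>UNIV. \<Sum>i\<in>UNIV. \<Gamma> $ (i, j) $ (i, l) * V $ l $ j)"
    by (subst sum.swap) (intro sum.cong refl sum.swap)
  also have "\<dots> = trace (ptrace1 \<Gamma> ** V)"
    by (simp add: trace_def matrix_matrix_mult_def ptrace1_def sum_distrib_right)
  finally show ?thesis by (simp add: rtrace_def)
qed

lemma rtrace_kronecker_sum: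
  "rtrace (\<Gamma> ** (U \<oplus>\<^sub>m V)) = rtrace (ptrace2 \<Gamma> ** U) + rtrace (ptrace1 \<Gamma> ** V)"
  by (simp add: kronecker_sum_def matrix_add_ldistrib rtrace_add rtrace_tensor_mat1
      rtrace_mat1_tensor)

text \<open>The form of \<open>ptrace2 \<Gamma>\<close> at \<open>x\<close> is the sum over
  \<open>j\<close> of the forms of \<Gamma> at the product of \<open>x\<close> with the basis vector
  \<open>j\<close>, which is \<open>y j\<close> below.\<close>

lemma psd_ptrace2:
  fixes \<Gamma> :: "('n::finite \<times> 'm::finite) cmat"
  assumes "psd \<Gamma>"
  shows "psd (ptrace2 \<Gamma>)"
  unfolding psd_def
proof (intro conjI allI)
  have herm: "\<Gamma> $ p $ q = cnj (\<Gamma> $ q $ p)" for p q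
    using assms unfolding psd_def hermitian_nth by blast
  show "hermitian (ptrace2 \<Gamma>)"
    unfolding hermitian_nth by (auto simp: ptrace2_def intro!: sum.cong herm)
  fix x :: "complex ^ 'n"
  define y where "y j = (\<chi> p :: 'n \<times> 'm. if snd p = j then x $ fst p else 0)" for j :: 'm
  have "0 \<le> (\<Sum>j\<in>UNIV. y j \<bullet> (\<Gamma> *v y j))"
    using assms by (simp add: psd_def sum_nonneg)
  also have "\<dots> = (\<Sum>j\<in>UNIV. \<Sum>i\<in>UNIV. x $ i \<bullet> (\<Sum>k\<in>UNIV. \<Gamma> $ (i, j) $ (k, j) * x $ k))"
    by (simp add: y_def inner_vec_def matrix_vector_mult_def sum_UNIV_prod
        if_distrib[of "\<lambda>x. _ * x"] if_distrib[of "\<lambda>x. x \<bullet> _"] cong: if_cong)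
  also have "\<dots> = (\<Sum>i\<in>UNIV. x $ i \<bullet> (\<Sum>j\<in>UNIV. \<Sum>k\<in>UNIV. \<Gamma> $ (i, j) $ (k, j) * x $ k))"
    by (subst sum.swap) (simp add: inner_sum_right)
  also have "\<dots> = (\<Sum>i\<in>UNIV. x $ i \<bullet> (\<Sum>k\<in>UNIV. \<Sum>j\<in>UNIV. \<Gamma> $ (i, j) $ (k, j) * x $ k))"
    by (intro sum.cong refl arg_cong2[of _ _ _ _ inner] sum.swap)
  also have "\<dots> = x \<bullet> (ptrace2 \<Gamma> *v x)"
    by (simp add: inner_vec_def matrix_vector_mult_def ptrace2_def sum_distrib_right)
  finally show "0 \<le> x \<bullet> (ptrace2 \<Gamma> *v x)" .
qed

lemma psd_ptrace1:
  fixes \<Gamma> :: "('n::finite \<times> 'm::finite) cmat"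
  assumes "psd \<Gamma>"
  shows "psd (ptrace1 \<Gamma>)"
  unfolding psd_def
proof (intro conjI allI)
  have herm: "\<Gamma> $ p $ q = cnj (\<Gamma> $ q $ p)" for p q
    using assms unfolding psd_def hermitian_nth by blast
  show "hermitian (ptrace1 \<Gamma>)"
    unfolding hermitian_nth by (auto simp: ptrace1_def intro!: sum.cong herm)
  fix x :: "complex ^ 'm"
  define y where "y i = (\<chi> p :: 'n \<times> 'm. if fst p = i then x $ snd p else 0)" for i :: 'n
  \<comment> \<open>The condition selects the outer index \<open>k\<close>; exchanging the sums
    makes it innermost, where it collapses.\<close>
  have *: "(\<Sum>k\<in>UNIV. \<Sum>l\<in>UNIV. \<Gamma> $ p $ (k, l) * (if k = i then x $ l else 0))
      = (\<Sum>l\<in>UNIV. \<Gamma> $ p $ (i, l) * x $ l)" for i p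
    by (subst sum.swap) (simp add: if_distrib[of "\<lambda>x. _ * x"] cong: if_cong)
  have **: "(\<Sum>k\<in>UNIV. \<Sum>l\<in>UNIV. (if k = i then x $ l else 0) \<bullet> f k l)
      = (\<Sum>l\<in>UNIV. x $ l \<bullet> f i l)" for i :: 'n and f
    by (subst sum.swap) (simp add: if_distrib[of "\<lambda>x. x \<bullet> _"] cong: if_cong)
  have "0 \<le> (\<Sum>i\<in>UNIV. y i \<bullet> (\<Gamma> *v y i))"
    using assms by (simp add: psd_def sum_nonneg)
  also have "\<dots> = (\<Sum>i\<in>UNIV. \<Sum>j\<in>UNIV. x $ j \<bullet> (\<Sum>l\<in>UNIV. \<Gamma> $ (i, j) $ (i, l) * x $ l))"
    by (simp add: y_def inner_vec_def matrix_vector_mult_def sum_UNIV_prod * ** cong: if_cong)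
  also have "\<dots> = (\<Sum>j\<in>UNIV. x $ j \<bullet> (\<Sum>i\<in>UNIV. \<Sum>l\<in>UNIV. \<Gamma> $ (i, j) $ (i, l) * x $ l))"
    by (subst sum.swap) (simp add: inner_sum_right)
  also have "\<dots> = (\<Sum>j\<in>UNIV. x $ j \<bullet> (\<Sum>l\<in>UNIV. \<Sum>i\<in>UNIV. \<Gamma> $ (i, j) $ (i, l) * x $ l))"
    by (intro sum.cong refl arg_cong2[of _ _ _ _ inner] sum.swap)
  also have "\<dots> = x \<bullet> (ptrace1 \<Gamma> *v x)"
    by (simp add: inner_vec_def matrix_vector_mult_def ptrace1_def sum_distrib_right)
  finally show "0 \<le> x \<bullet> (ptrace1 \<Gamma> *v x)" .
qed

section \<open>Weak duality\<close>

lemma mkernel_posdef: "posdef A \<Longrightarrow> mkernel A = {0}"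
  by (force simp: mkernel_def posdef_def)

lemma hermitian_diff: "hermitian A \<Longrightarrow> hermitian B \<Longrightarrow> hermitian (A - B)"
  by (simp add: hermitian_def vec_eq_iff)

lemma hermitian_scaleR: "hermitian A \<Longrightarrow> hermitian (c *\<^sub>R A)"
  by (simp add: hermitian_def vec_eq_iff)

lemma hermitian_kronecker_sum:
  assumes "hermitian U" "hermitian V"
  shows "hermitian (U \<oplus>\<^sub>m V)"
proof -
  have "cnj (U $ j $ i) = U $ i $ j" "cnj (V $ l $ k) = V $ k $ l" for i j k l
    using assms unfolding hermitian_nth by metis+
  then show ?thesis
    unfolding hermitian_nth by (simp add: kronecker_sum_def tensor_def mat_def)
qed

text \<open>The relative entropy bound at \<open>H = - U / \<tau>\<close>, multiplied by
  \<open>\<tau>\<close>. The summand \<rho> in \<open>umegaki\<close> accounts for the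
  \<open>- mat 1\<close> of the dual term, and the trivial kernel of \<rho> makes
  \<open>umegaki\<close> finite.\<close>

lemma umegaki_dual_bound:
  assumes "0 < \<tau>" "psd \<gamma>" "posdef \<rho>" "hermitian U"
  shows "ereal (- rtrace (\<gamma> ** U) - \<tau> * rtrace ((mexp (- (U /\<^sub>R \<tau>)) - mat 1) ** \<rho>))
    \<le> ereal \<tau> * umegaki \<gamma> \<rho>"
proof -
  have H: "- (U /\<^sub>R \<tau>) = (- 1 / \<tau>) *\<^sub>R U" by (simp add: divide_inverse)
  have "rtrace (\<gamma> ** (- (U /\<^sub>R \<tau>))) \<le>
      rtrace (\<gamma> ** (mlog \<gamma> - mlog \<rho> - mat 1)) + rtrace (mexp (- (U /\<^sub>R \<tau>)) ** \<rho>)"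
    using assms by (intro relative_entropy_exp_bound) (simp_all only: H hermitian_scaleR)
  moreover have "rtrace (\<gamma> ** (- (U /\<^sub>R \<tau>))) = - rtrace (\<gamma> ** U) / \<tau>"
    unfolding H matrix_mult_scaleR_right rtrace_scaleR by simp
  ultimately have "- rtrace (\<gamma> ** U) / \<tau> \<le>
      rtrace (\<gamma> ** (mlog \<gamma> - mlog \<rho> - mat 1)) + rtrace (mexp (- (U /\<^sub>R \<tau>)) ** \<rho>)"
    by (simp only:)
  then have "- rtrace (\<gamma> ** U) \<le>
      (rtrace (\<gamma> ** (mlog \<gamma> - mlog \<rho> - mat 1)) + rtrace (mexp (- (U /\<^sub>R \<tau>)) ** \<rho>)) * \<tau>"
    by (simp only: pos_divide_le_eq[OF assms(1)])
  moreover have "umegaki \<gamma> \<rho> = ereal (rtrace (\<gamma> ** (mlog \<gamma> - mlog \<rho> - mat 1) + \<rho>))"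
    using mkernel_posdef[OF assms(3)] by (simp add: umegaki_def mkernel_def)
  ultimately show ?thesis
    by (simp add: matrix_mult_diff_left rtrace_add rtrace_diff algebra_simps)
qed

text \<open>Klein's inequality at \<open>K / \<epsilon>\<close>, scaled by
  \<open>\<epsilon>\<close>, bounds the cost and entropy from below. The traces of the marginals
  against \<open>U\<close> and \<open>V\<close> that it produces cancel against those in the two
  \<open>umegaki\<close> bounds.\<close>

lemma dual_le_primal:
  assumes "\<epsilon> > 0" "\<tau>1 > 0" "\<tau>2 > 0" "hermitian C" "posdef \<rho>" "posdef \<sigma>"
    and \<Gamma>: "psd \<Gamma>" and "hermitian U" "hermitian V"
  shows "ereal (dual \<epsilon> \<tau>1 \<tau>2 C \<rho> \<sigma> U V) \<le> primal \<epsilon> \<tau>1 \<tau>2 C \<rho> \<sigma> \<Gamma>"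
proof -
  define K where "K = U \<oplus>\<^sub>m V - C"
  define E where "E = rtrace (mexp (K /\<^sub>R \<epsilon>))"
  have "rtrace (\<Gamma> ** (K /\<^sub>R \<epsilon>)) \<le> vn_entropy \<Gamma> + E"
    unfolding E_def K_def using assms
    by (intro Klein_inequality_exp hermitian_scaleR hermitian_diff hermitian_kronecker_sum)
  then have "inverse \<epsilon> * rtrace (\<Gamma> ** K) \<le> vn_entropy \<Gamma> + E"
    by (simp only: matrix_mult_scaleR_right rtrace_scaleR)
  then have "rtrace (\<Gamma> ** K) \<le> \<epsilon> * vn_entropy \<Gamma> + \<epsilon> * E"
    using \<open>\<epsilon> > 0\<close> by (simp add: field_simps)
  then have "ereal (rtrace (ptrace2 \<Gamma> ** U) + rtrace (ptrace1 \<Gamma> ** V) - \<epsilon> * E)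
      \<le> ereal (rtrace (C ** \<Gamma>) + \<epsilon> * vn_entropy \<Gamma>)"
    by (simp add: K_def matrix_mult_diff_right rtrace_diff rtrace_kronecker_sum rtrace_commute[of C])
  note bound = add_mono[OF add_mono[OF this umegaki_dual_bound] umegaki_dual_bound,
      OF \<open>\<tau>1 > 0\<close> psd_ptrace2[OF \<Gamma>] \<open>posdef \<rho>\<close> \<open>hermitian U\<close>
      \<open>\<tau>2 > 0\<close> psd_ptrace1[OF \<Gamma>] \<open>posdef \<sigma>\<close> \<open>hermitian V\<close>]
  have "dual \<epsilon> \<tau>1 \<tau>2 C \<rho> \<sigma> U V =
      rtrace (ptrace2 \<Gamma> ** U) + rtrace (ptrace1 \<Gamma> ** V) - \<epsilon> * E
      + (- rtrace (ptrace2 \<Gamma> ** U) - \<tau>1 * rtrace ((mexp (- (U /\<^sub>R \<tau>1)) - mat 1) ** \<rho>))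
      + (- rtrace (ptrace1 \<Gamma> ** V) - \<tau>2 * rtrace ((mexp (- (V /\<^sub>R \<tau>2)) - mat 1) ** \<sigma>))"
    by (simp add: dual_def E_def K_def)
  with bound show ?thesis
    by (simp only: primal_def plus_ereal.simps)
qed

theorem mainTheorem3:
  fixes \<epsilon> \<tau>1 \<tau>2 :: real
    and C :: "('n::finite \<times> 'm::finite) cmat"
    and \<rho> :: "'n cmat" and \<sigma> :: "'m cmat"
  assumes "\<epsilon> > 0" and "\<tau>1 > 0" and "\<tau>2 > 0"
    and "hermitian C" and "posdef \<rho>" and "posdef \<sigma>"
  shows "(INF \<Gamma>\<in>{\<Gamma>. psd \<Gamma>}. primal \<epsilon> \<tau>1 \<tau>2 C \<rho> \<sigma> \<Gamma>)
         \<ge> (SUP (U, V)\<in>{U. hermitian U} \<times> {V. hermitian V}. ereal (dual \<epsilon> \<tau>1 \<tau>2 C \<rho> \<sigma> U V))"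
  using dual_le_primal[OF assms] by (intro SUP_least INF_greatest) auto

end
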